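(* Let $(X,p)$ and $(Y,q)$ be two quasi-normed cones. If $f:X\to Y$ is an open, bijective, continuous linear mapping, then it is an isomorphism.
   Context: $\mathbb{R}^+$ is the set of nonnegative real numbers. A cone (on $\mathbb{R}^+$) is a triple $(X,+,\cdot)$ such that $(X,+)$ is an abelian monoid with neutral element $0$ and $\cdot:\mathbb{R}^+\times X\to X$ satisfies, for all $x,y\in X$ and $r,s\in\mathbb{R}^+$: $r\cdot(s\cdot x)=(rs)\cdot x$; $r\cdot(x+y)=r\cdot x+r\cdot y$; $(r+s)\cdot x=r\cdot x+s\cdot x$; $1\cdot x=x$; $0\cdot x=0$. It is cancellative if $z+x=z+y$ implies $x=y$. A linear mapping between cones is a mapping $f$ with $f(\alpha\cdot x+\beta\cdot y)=\alpha\cdot f(x)+\beta\cdot f(y)$ for all $x,y$ and $\alpha,\beta\in\mathbb{R}^+$. $-x$ denotes the additive inverse of $x$ when it exists. A quasi-norm on a cone $X$ is a function $q:X\to\mathbb{R}^+$ such that for all $x,y\in X$, $r\in\mathbb{R}^+$: (i) $x=0$ if and only if there is $-x\in X$ and $q(x)=q(-x)=0$; (ii) $q(r\cdot x)=rq(x)$; (iii) $q(x+y)\le q(x)+q(y)$. A quasi-normed cone is a pair $(X,p)$ where $X$ is a cancellative cone and $p$ is a quasi-norm on $X$. Its induced extended quasi-metric is $d_p(x,y)=p(a)$ if $y=x+a$ with $a\in X$, and $d_p(x,y)=+\infty$ if $y\notin x+X$. $\mathcal{T}(d_p)$ is the topology on $X$ with base the balls $\{y\in X: d_p(x,y)<r\}$,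 $x\in X$, $r>0$. Continuity and openness of mappings between $(X,p)$ and $(Y,q)$ refer to the topologies $\mathcal{T}(d_p)$ and $\mathcal{T}(d_q)$. An isomorphism between quasi-normed cones is a continuous linear bijective mapping whose inverse is continuous. *)

theory Defs
  imports "HOL-Analysis.Analysis" "HOL-Algebra.Module"
begin

section \<open>Cones\<close>

text \<open>
  The module record is reused for its carrier, addition, zero and scalar multiplication; its
  fields for ring multiplication and unit are never constrained.  Scalars are nonnegative
  reals, and scalar multiplication by negative reals is left unspecified.
\<close>

locale cone = abelian_monoid C for C :: "(real, 'a, 'm) module_scheme" (structure) +
  assumes scale_closed: "\<lbrakk>0 \<le> r; x \<in> carrier C\<rbrakk> \<Longrightarrow> r \<odot> x \<in> carrier C"
    and scale_assoc: "\<lbrakk>0 \<le> r; 0 \<le> s; x \<in> carrier C\<rbrakk> \<Longrightarrow> r \<odot> (s \<odot> x) = (r * s) \<odot> x"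
    and scale_add_right:
      "\<lbrakk>0 \<le> r; x \<in> carrier C; y \<in> carrier C\<rbrakk> \<Longrightarrow> r \<odot> (x \<oplus> y) = r \<odot> x \<oplus> r \<odot> y"
    and scale_add_left:
      "\<lbrakk>0 \<le> r; 0 \<le> s; x \<in> carrier C\<rbrakk> \<Longrightarrow> (r + s) \<odot> x = r \<odot> x \<oplus> s \<odot> x"
    and scale_one: "x \<in> carrier C \<Longrightarrow> 1 \<odot> x = x"
    and scale_zero: "x \<in> carrier C \<Longrightarrow> 0 \<odot> x = \<zero>"

locale cancellative_cone = cone +
  assumes add_left_cancel:
    "\<lbrakk>x \<in> carrier C; y \<in> carrier C; z \<in> carrier C; z \<oplus> x = z \<oplus> y\<rbrakk> \<Longrightarrow> x = y"

definition cone_linear ::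
  "(real, 'a, 'm) module_scheme \<Rightarrow> (real, 'b, 'n) module_scheme \<Rightarrow> ('a \<Rightarrow> 'b) \<Rightarrow> bool" where
  "cone_linear C D f \<longleftrightarrow>
     f \<in> carrier C \<rightarrow> carrier D \<and>
     (\<forall>x \<in> carrier C. \<forall>y \<in> carrier C. \<forall>\<alpha>\<ge>0. \<forall>\<beta>\<ge>0.
        f (\<alpha> \<odot>\<^bsub>C\<^esub> x \<oplus>\<^bsub>C\<^esub> \<beta> \<odot>\<^bsub>C\<^esub> y) = \<alpha> \<odot>\<^bsub>D\<^esub> f x \<oplus>\<^bsub>D\<^esub> \<beta> \<odot>\<^bsub>D\<^esub> f y)"

section \<open>Quasi-normed cones\<close>

text \<open>In the second axiom below, \<open>y\<close> plays the role of the additive inverse \<open>-x\<close>.\<close>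

locale quasi_normed_cone = cancellative_cone +
  fixes p :: "'a \<Rightarrow> real"
  assumes qnorm_nonneg: "x \<in> carrier C \<Longrightarrow> 0 \<le> p x"
    and qnorm_eq_zero:
      "x \<in> carrier C \<Longrightarrow>
         x = \<zero> \<longleftrightarrow> (\<exists>y \<in> carrier C. x \<oplus> y = \<zero> \<and> p x = 0 \<and> p y = 0)"
    and qnorm_scale: "\<lbrakk>0 \<le> r; x \<in> carrier C\<rbrakk> \<Longrightarrow> p (r \<odot> x) = r * p x"
    and qnorm_triangle: "\<lbrakk>x \<in> carrier C; y \<in> carrier C\<rbrakk> \<Longrightarrow> p (x \<oplus> y) \<le> p x + p y"

text \<open>The element selected by \<open>THE\<close> is unique by cancellativity.\<close>

definition qdist :: "(real, 'a, 'm) module_scheme \<Rightarrow> ('a \<Rightarrow> real) \<Rightarrow> 'a \<Rightarrow> 'a \<Rightarrow> ennreal" where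
  "qdist C p x y =
     (if \<exists>a \<in> carrier C. y = x \<oplus>\<^bsub>C\<^esub> a
      then ennreal (p (THE a. a \<in> carrier C \<and> y = x \<oplus>\<^bsub>C\<^esub> a))
      else \<infinity>)"

definition qball :: "(real, 'a, 'm) module_scheme \<Rightarrow> ('a \<Rightarrow> real) \<Rightarrow> 'a \<Rightarrow> real \<Rightarrow> 'a set" where
  "qball C p x r = {y \<in> carrier C. qdist C p x y < ennreal r}"

definition qtopology :: "(real, 'a, 'm) module_scheme \<Rightarrow> ('a \<Rightarrow> real) \<Rightarrow> 'a topology" where
  "qtopology C p =
     topology (arbitrary union_of (\<lambda>B. \<exists>x \<in> carrier C. \<exists>r>0. B = qball C p x r))"

definition cone_isomorphism ::
  "(real, 'a, 'm) module_scheme \<Rightarrow> ('a \<Rightarrow> real) \<Rightarrow>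
   (real, 'b, 'n) module_scheme \<Rightarrow> ('b \<Rightarrow> real) \<Rightarrow> ('a \<Rightarrow> 'b) \<Rightarrow> bool" where
  "cone_isomorphism C p D q f \<longleftrightarrow>
     cone_linear C D f \<and>
     bij_betw f (carrier C) (carrier D) \<and>
     continuous_map (qtopology C p) (qtopology D q) f \<and>
     continuous_map (qtopology D q) (qtopology C p) (inv_into (carrier C) f)"

section \<open>The balls form a base\<close>

context quasi_normed_cone
begin

lemma qnorm_zero: "p \<zero> = 0"
  using qnorm_eq_zero[of \<zero>] by auto

lemma qdist_add:
  assumes "x \<in> carrier C" "a \<in> carrier C"
  shows "qdist C p x (x \<oplus> a) = ennreal (p a)"
proof -
  have "(THE b. b \<in> carrier C \<and> x \<oplus> a = x \<oplus> b) = a"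
    using assms add_left_cancel by (intro the_equality) metis+
  then show ?thesis
    using assms by (auto simp: qdist_def)
qed

lemma mem_qball_iff:
  assumes "x \<in> carrier C"
  shows "y \<in> qball C p x r \<longleftrightarrow> (\<exists>a \<in> carrier C. y = x \<oplus> a \<and> p a < r)"
proof
  assume y: "y \<in> qball C p x r"
  then obtain a where a: "a \<in> carrier C" "y = x \<oplus> a"
    by (auto simp: qball_def qdist_def split: if_splits)
  with y assms have "ennreal (p a) < ennreal r"
    by (simp add: qball_def qdist_add)
  with a show "\<exists>a \<in> carrier C. y = x \<oplus> a \<and> p a < r"
    using qnorm_nonneg by (auto simp: ennreal_less_iff)
next
  assume "\<exists>a \<in> carrier C. y = x \<oplus> a \<and> p a < r"
  with assms show "y \<in> qball C p x r"
    by (auto simp: qball_def qdist_add ennreal_less_iff qnorm_nonneg)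
qed

lemma centre_in_qball: "x \<in> carrier C \<Longrightarrow> 0 < r \<Longrightarrow> x \<in> qball C p x r"
  using mem_qball_iff[of x x r] qnorm_zero by (metis r_zero zero_closed)

lemma qball_inner:
  assumes "x \<in> carrier C" "z \<in> qball C p x r"
  obtains e where "0 < e" "qball C p z e \<subseteq> qball C p x r"
proof -
  obtain a where a: "a \<in> carrier C" "z = x \<oplus> a" "p a < r"
    using assms mem_qball_iff by blast
  have "qball C p z (r - p a) \<subseteq> qball C p x r"
  proof
    fix y assume y: "y \<in> qball C p z (r - p a)"
    have "z \<in> carrier C"
      using a assms by simp
    with y obtain b where b: "b \<in> carrier C" "y = z \<oplus> b" "p b < r - p a"
      using mem_qball_iff by blast
    have "y = x \<oplus> (a \<oplus> b)"
      using a b assms by (simp add: a_assoc)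
    moreover have "p (a \<oplus> b) < r"
      using qnorm_triangle[of a b] a b by simp
    ultimately show "y \<in> qball C p x r"
      using mem_qball_iff[OF assms(1), of y r] a b by blast
  qed
  with that[of "r - p a"] a show ?thesis by simp
qed

lemma istopology_qballs:
  "istopology (arbitrary union_of (\<lambda>B. \<exists>x \<in> carrier C. \<exists>r>0. B = qball C p x r))"
    (is "istopology (arbitrary union_of ?P)")
  unfolding istopology_base_eq
proof (intro allI impI)
  fix S T assume "?P S \<and> ?P T"
  then obtain x r y s where S: "x \<in> carrier C" "S = qball C p x r"
    and T: "y \<in> carrier C" "T = qball C p y s"
    by blast
  have "\<exists>U. ?P U \<and> z \<in> U \<and> U \<subseteq> S \<inter> T" if z: "z \<in> S \<inter> T" for z
  proof -
    have zC: "z \<in> carrier C"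
      using z S by (auto simp: qball_def)
    obtain d where d: "0 < d" "qball C p z d \<subseteq> S"
      using qball_inner[of x z r] S z by blast
    obtain e where e: "0 < e" "qball C p z e \<subseteq> T"
      using qball_inner[of y z s] T z by blast
    have "qball C p z (min d e) \<subseteq> qball C p z d \<inter> qball C p z e"
      using zC by (auto simp: mem_qball_iff)
    then have "qball C p z (min d e) \<subseteq> S \<inter> T"
      using d e by blast
    moreover have "0 < min d e"
      using d e by simp
    ultimately show ?thesis
      using zC centre_in_qball by blast
  qed
  then show "(arbitrary union_of ?P) (S \<inter> T)"
    unfolding arbitrary_union_of_alt by blast
qed

lemma openin_qtopology:
  "openin (qtopology C p) =
     arbitrary union_of (\<lambda>B. \<exists>x \<in> carrier C. \<exists>r>0. B = qball C p x r)"
  unfolding qtopology_def by (rule topology_inverse'[OF istopology_qballs])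

lemma topspace_qtopology: "topspace (qtopology C p) = carrier C"
proof
  show "topspace (qtopology C p) \<subseteq> carrier C"
    unfolding topspace_def openin_qtopology
    by (auto simp: union_of_def arbitrary_def qball_def)
  have "openin (qtopology C p) (carrier C)"
    unfolding openin_qtopology arbitrary_union_of_alt
  proof
    fix x assume x: "x \<in> carrier C"
    then show "\<exists>U. (\<exists>x \<in> carrier C. \<exists>r>0. U = qball C p x r) \<and> x \<in> U \<and> U \<subseteq> carrier C"
      using centre_in_qball[OF x zero_less_one] zero_less_one[where 'a = real]
      by (metis (no_types, lifting) qball_def mem_Collect_eq subsetI)
  qed
  then show "carrier C \<subseteq> topspace (qtopology C p)"
    by (rule openin_subset)
qed

end

end

theory Submission
  imports Defs
begin

text \<open>For a bijection, the preimage of a set \<open>U\<close> under the inverse is the image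
  of \<open>U\<close> under \<open>f\<close>. Openness of \<open>f\<close> is therefore exactly
  continuity of its inverse; the other clauses of \<open>cone_isomorphism\<close> are
  hypotheses.\<close>

theorem corollary28:
  fixes X :: "(real, 'a, 'm) module_scheme" and Y :: "(real, 'b, 'n) module_scheme"
    and p :: "'a \<Rightarrow> real" and q :: "'b \<Rightarrow> real" and f :: "'a \<Rightarrow> 'b"
  assumes "quasi_normed_cone X p" and "quasi_normed_cone Y q"
    and "open_map (qtopology X p) (qtopology Y q) f"
    and "bij_betw f (carrier X) (carrier Y)"
    and "continuous_map (qtopology X p) (qtopology Y q) f"
    and "cone_linear X Y f"
  shows "cone_isomorphism X p Y q f"
proof -
  \<comment> \<open>This turns the bijection of carriers into one of topological spaces.\<close>
  have top: "topspace (qtopology X p) = carrier X" "topspace (qtopology Y q) = carrier Y"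
    using assms(1,2) by (simp_all add: quasi_normed_cone.topspace_qtopology)
  have "continuous_map (qtopology Y q) (qtopology X p) (inv_into (carrier X) f)"
  \<comment> \<open>With openness supplied, it remains that \<open>f\<close> and
    \<open>inv_into (carrier X) f\<close> are mutually inverse between the topspaces.\<close>
  proof (rule open_eq_continuous_inverse_map[THEN iffD1, OF _ _ assms(3)])
    show "f x \<in> topspace (qtopology Y q) \<and> inv_into (carrier X) f (f x) = x"
      if "x \<in> topspace (qtopology X p)" for x
      using that assms(4) by (simp add: top bij_betw_inv_into_left bij_betw_apply)
    show "inv_into (carrier X) f y \<in> topspace (qtopology X p) \<and> f (inv_into (carrier X) f y) = y"
      if "y \<in> topspace (qtopology Y q)" for y
      using that assms(4) bij_betw_inv_into[OF assms(4)]
      by (simp add: top bij_betw_inv_into_right bij_betw_apply)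
  qed
  with assms(4-6) show ?thesis
    by (simp add: cone_isomorphism_def)
qed

end
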